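(* Let $D$ be a link diagram. (i) We have $$split(D)\leq d(|D|).$$ (ii) We have $$split(D)\leq lsplit(D)\leq ld(D)\leq\frac{lc(D)}{2}\leq\frac{c(D)}{2}.$$
   Context: $D$ is a diagram (on $\mathbb{S}^2$) of an $r$-component link with components $D^1,\dots,D^r$. $c(D)$ is the number of crossing points of $D$. A crossing is a self-crossing if both strands belong to the same component, and a non-self crossing otherwise; $lc(D)$ is the number of non-self crossings. A link is completely splittable if it has a diagram without non-self crossings. $split(D)$ (complete splitting number) is the smallest number of crossing changes needed to obtain a diagram of a completely splittable link from $D$. $lsplit(D)$ (linking complete splitting number) is the smallest number of crossing changes at non-self crossings needed to obtain a diagram of a completely splittable link from $D$. A base point sequence ${\bf a}=(a_1,\dots,a_r)$ of $D$ is an ordered sequence of points, exactly one on each component, none at a crossing point; its order determines the order of the components, and we write $D_{\bf a}=D^1_{a_1}\cup\dots\cup D^r_{a_r}$. For $i<j$, a crossing $p$ of $D^i$ and $D^j$ is a warping crossing point between $D^i_{a_i}$ and $D^j_{a_j}$ if $D^i$ is the under-strand at $p$. $ld(D_{\bf a})$ is the number of such crossing points over all pairs $i<j$, and the linking warping degree is $ld(D)=\min_{\bf a}ld(D_{\bf a})$ over all base point sequences (including all orders of the components). If $D$ is oriented, a self-crossing $p$ of $D^i$ is a warping crossing point of $D^i_{a_i}$ if, travelling along $D^i$ from $a_i$, one meets $p$ first at its under-crossing; $d(D_{\bf a})$ is the total number of warping crossing points of both kinds, and $d(D)=\min_{\bf a}d(D_{\bf a})$. $|D|$ is $D$ with orientation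 forgotten, and $d(|D|)$ is the minimum of $d(D)$ over all choices of orientations of the components of $|D|$. *)

theory Defs
  imports "HOL-Analysis.Analysis"
begin

text \<open>
  The projection sphere is the unit sphere of \<open>\<real>\<^sup>3\<close>, and links are projected to it radially from the
  origin: \<open>\<real>\<^sup>3 - {0}\<close> is the product of the sphere with the open half-line of radii, and the
  larger radius counts as higher.

  The component \<open>i < num_components D\<close> of a diagram is the closed curve \<open>curve D i\<close>, parametrised with
  period 1. A pair \<open>(i, t)\<close> with \<open>0 \<le> t < 1\<close> names the passage of component \<open>i\<close> at time \<open>t\<close>, and
  \<open>underpasses D\<close> is the set of those passages that are the under-strand of a crossing. The diagram as
  such carries no orientation; orientations are a separate argument below.
\<close>

record diagram =
  num_components :: nat
  curve :: "nat \<Rightarrow> real \<Rightarrow> real^3"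
  underpasses :: "(nat \<times> real) set"

definition passages :: "diagram \<Rightarrow> (nat \<times> real) set" where
  "passages D = {..<num_components D} \<times> {0..<1}"

definition point_at :: "diagram \<Rightarrow> nat \<times> real \<Rightarrow> real^3" where
  "point_at D x = curve D (fst x) (snd x)"

definition velocity :: "diagram \<Rightarrow> nat \<times> real \<Rightarrow> real^3" where
  "velocity D x = vector_derivative (curve D (fst x)) (at (snd x))"

definition strands_at :: "diagram \<Rightarrow> real^3 \<Rightarrow> (nat \<times> real) set" where
  "strands_at D p = {x \<in> passages D. point_at D x = p}"

definition crossings :: "diagram \<Rightarrow> (real^3) set" where
  "crossings D = {p. card (strands_at D p) = 2}"

definition regular_spherical_closed_curve :: "(real \<Rightarrow> real^3) \<Rightarrow> bool" where
  "regular_spherical_closed_curve g \<longleftrightarrow>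
     (\<forall>t. norm (g t) = 1) \<and> (\<forall>t. g (t + 1) = g t) \<and>
     g C1_differentiable_on UNIV \<and> (\<forall>t. vector_derivative g (at t) \<noteq> 0)"

text \<open>
  The only multiple points of a diagram are finitely many transverse double points. Linear
  independence of the two velocities is expressed as non-collinearity with the origin.
\<close>

definition link_diagram :: "diagram \<Rightarrow> bool" where
  "link_diagram D \<longleftrightarrow>
     0 < num_components D \<and>
     (\<forall>i<num_components D. regular_spherical_closed_curve (curve D i)) \<and>
     (\<forall>p. finite (strands_at D p) \<and> card (strands_at D p) \<le> 2) \<and>
     finite (crossings D) \<and>
     (\<forall>x\<in>passages D. \<forall>y\<in>passages D.
        x \<noteq> y \<and> point_at D x = point_at D y \<longrightarrow> \<not> collinear {0, velocity D x, velocity D y}) \<and>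
     underpasses D \<subseteq> {x \<in> passages D. point_at D x \<in> crossings D} \<and>
     (\<forall>p\<in>crossings D. card (strands_at D p \<inter> underpasses D) = 1)"

definition nonself_crossings :: "diagram \<Rightarrow> (real^3) set" where
  "nonself_crossings D =
     {p \<in> crossings D. \<exists>i j s t. i \<noteq> j \<and> strands_at D p = {(i, s), (j, t)}}"

definition crossing_number :: "diagram \<Rightarrow> nat" where
  "crossing_number D = card (crossings D)"

definition nonself_crossing_number :: "diagram \<Rightarrow> nat"  (\<open>lc\<close>) where
  "lc D = card (nonself_crossings D)"

text \<open>The crossing changes at all crossings in \<open>S\<close>.\<close>

definition change_crossings :: "diagram \<Rightarrow> (real^3) set \<Rightarrow> diagram" where
  "change_crossings D S = D\<lparr>underpasses := sym_diff (underpasses D) {x \<in> passages D. point_at D x \<in> S}\<rparr>"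


subsection \<open>Links and their diagrams\<close>

text \<open>
  A subset \<open>L\<close> of \<open>\<real>\<^sup>3\<close> projects to \<open>D\<close> if it is obtained by assigning to each passage a radius, in
  accordance with the over/under information of \<open>D\<close>. Such an \<open>L\<close> is automatically a disjoint
  union of regularly embedded circles, one for each component.
\<close>

definition projects_to :: "(real^3) set \<Rightarrow> diagram \<Rightarrow> bool" where
  "projects_to L D \<longleftrightarrow>
     (\<exists>\<rho> :: nat \<Rightarrow> real \<Rightarrow> real.
        (\<forall>i<num_components D. \<rho> i C1_differentiable_on UNIV \<and>
           (\<forall>t. \<rho> i t > 0) \<and> (\<forall>t. \<rho> i (t + 1) = \<rho> i t)) \<and>
        (\<forall>p\<in>crossings D. \<forall>(i, s)\<in>strands_at D p. \<forall>(j, t)\<in>strands_at D p.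
           (i, s) \<in> underpasses D \<and> (j, t) \<notin> underpasses D \<longrightarrow> \<rho> i s < \<rho> j t) \<and>
        L = (\<lambda>(i, t). \<rho> i t *\<^sub>R curve D i t) ` passages D)"

definition ambient_isotopic :: "(real^3) set \<Rightarrow> (real^3) set \<Rightarrow> bool" where
  "ambient_isotopic L L' \<longleftrightarrow>
     (\<exists>h. homotopic_with_canon (\<lambda>f. \<exists>g. homeomorphism UNIV UNIV f g) UNIV UNIV id h \<and> h ` L = L')"

definition diagram_of :: "diagram \<Rightarrow> (real^3) set \<Rightarrow> bool" where
  "diagram_of D L \<longleftrightarrow> link_diagram D \<and> (\<exists>L'. ambient_isotopic L L' \<and> projects_to L' D)"

definition completely_splittable :: "(real^3) set \<Rightarrow> bool" where
  "completely_splittable L \<longleftrightarrow> (\<exists>D. diagram_of D L \<and> nonself_crossings D = {})"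

definition splits_by_changing :: "diagram \<Rightarrow> (real^3) set \<Rightarrow> bool" where
  "splits_by_changing D S \<longleftrightarrow>
     (\<exists>L. diagram_of (change_crossings D S) L \<and> completely_splittable L)"

text \<open>
  All minima below are taken with \<open>LEAST\<close>, whose value is unspecified if there is no candidate at
  all, so that an upper bound for such a number entails that the minimum is attained.
\<close>

definition complete_splitting_number :: "diagram \<Rightarrow> nat"  (\<open>split\<close>) where
  "split D = (LEAST n. \<exists>S \<subseteq> crossings D. card S = n \<and> splits_by_changing D S)"

definition linking_complete_splitting_number :: "diagram \<Rightarrow> nat"  (\<open>lsplit\<close>) where
  "lsplit D = (LEAST n. \<exists>S \<subseteq> nonself_crossings D. card S = n \<and> splits_by_changing D S)"


subsection \<open>Warping degrees\<close>

text \<open>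
  A base point sequence is a list of passages; its order is the order of the components.
\<close>

definition base_point_sequence :: "diagram \<Rightarrow> (nat \<times> real) list \<Rightarrow> bool" where
  "base_point_sequence D a \<longleftrightarrow>
     set a \<subseteq> passages D \<and> distinct (map fst a) \<and> fst ` set a = {..<num_components D} \<and>
     (\<forall>x\<in>set a. point_at D x \<notin> crossings D)"

definition nonself_warping_crossings :: "diagram \<Rightarrow> (nat \<times> real) list \<Rightarrow> (real^3) set" where
  "nonself_warping_crossings D a =
     {p \<in> crossings D. \<exists>k l s t. k < l \<and> l < length a \<and>
        strands_at D p = {(fst (a ! k), s), (fst (a ! l), t)} \<and> (fst (a ! k), s) \<in> underpasses D}"

text \<open>
  An orientation \<open>e\<close> assigns \<open>True\<close> to the components traversed in the direction of their
  parametrisation. Then \<open>travel_time e b x\<close> is the time needed to get from the base point \<open>b\<close>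
  to the passage \<open>x\<close> of the same component, following the orientation.
\<close>

definition travel_time :: "(nat \<Rightarrow> bool) \<Rightarrow> nat \<times> real \<Rightarrow> nat \<times> real \<Rightarrow> real" where
  "travel_time e b x = (if e (fst b) then frac (snd x - snd b) else frac (snd b - snd x))"

definition self_warping_crossings ::
  "diagram \<Rightarrow> (nat \<Rightarrow> bool) \<Rightarrow> (nat \<times> real) list \<Rightarrow> (real^3) set" where
  "self_warping_crossings D e a =
     {p \<in> crossings D. \<exists>b\<in>set a. \<exists>s t. s \<noteq> t \<and>
        strands_at D p = {(fst b, s), (fst b, t)} \<and> (fst b, s) \<in> underpasses D \<and>
        travel_time e b (fst b, s) < travel_time e b (fst b, t)}"

definition linking_warping_degree_at :: "diagram \<Rightarrow> (nat \<times> real) list \<Rightarrow> nat" where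
  "linking_warping_degree_at D a = card (nonself_warping_crossings D a)"

definition linking_warping_degree :: "diagram \<Rightarrow> nat"  (\<open>ld\<close>) where
  "ld D = (LEAST n. \<exists>a. base_point_sequence D a \<and> linking_warping_degree_at D a = n)"

definition warping_degree_at :: "diagram \<Rightarrow> (nat \<Rightarrow> bool) \<Rightarrow> (nat \<times> real) list \<Rightarrow> nat" where
  "warping_degree_at D e a =
     card (nonself_warping_crossings D a) + card (self_warping_crossings D e a)"

definition warping_degree :: "diagram \<Rightarrow> (nat \<Rightarrow> bool) \<Rightarrow> nat" where
  "warping_degree D e =
     (LEAST n. \<exists>a. base_point_sequence D a \<and> warping_degree_at D e a = n)"

definition unoriented_warping_degree :: "diagram \<Rightarrow> nat" where
  "unoriented_warping_degree D = (LEAST n. \<exists>e. warping_degree D e = n)"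

end

theory Submission
  imports Defs
begin

text \<open>
  All inequalities come from one fact: if the non-self warping crossings for a base point sequence \<open>a\<close>
  are changed, the resulting diagram is that of a completely splittable link
  (\<open>splits_by_changing_nonself_warping_crossings\<close>). This gives \<open>lsplit D \<le> ld D\<close>. Moreover
  \<open>split D \<le> lsplit D\<close>, because \<open>lsplit\<close> is the minimum over fewer sets of crossings, and the
  inequality for \<open>d(|D|)\<close> follows since \<open>d\<close> only adds self-crossings to the count for \<open>ld\<close>. Finally, the
  non-self warping crossings for \<open>a\<close> and for the reversed order of \<open>a\<close> are disjoint sets of non-self
  crossings, so one of the two sets has at most half of them.

  After the crossing changes the diagram is layered: one can order the components so that each of them
  passes over all the later ones. That a layered diagram represents a completely splittable link
  (\<open>layered_diagram_completely_splittable\<close>) is shown by an explicit isotopy. Realise the link with its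
  components in disjoint concentric spherical shells. The projection of a component to the sphere misses
  some point, and the hyperbolic Moebius transformation of the sphere that repels from this point and
  attracts to its antipode shrinks the component into an arbitrarily small disc around the antipode.
  These transformations depend smoothly on a parameter in the open unit ball, with the identity at 0
  (\<open>boost\<close>); letting the parameter depend on the radius, one moves every shell by its own
  transformation and interpolates between the shells (\<open>ambient_isotopic_twist\<close>). If the missed points
  are distinct, the shrunken components have disjoint projections. As each projected component has
  only been changed by a diffeomorphism of the sphere, the result is again a link diagram, and
  only self-crossings remain (\<open>link_diagram_boost_components\<close>).
\<close>

section \<open>Boosts of the sphere\<close>

text \<open>
  On the unit sphere this is the Lorentz boost of the celestial sphere with parameter \<open>a\<close>, i.e. the
  hyperbolic Moebius transformation that pushes every point from \<open>- a / \<bar>a\<bar>\<close> towards \<open>a / \<bar>a\<bar>\<close>.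
  The formula is rational in \<open>a\<close> as well as in the point, and it is the identity for \<open>a = 0\<close>; so the
  boost may be switched on continuously, and may depend continuously on the radius.
\<close>

definition boost :: "'a::real_inner \<Rightarrow> 'a \<Rightarrow> 'a" where
  "boost a z = (1 / (1 + a \<bullet> a + 2 * (a \<bullet> z))) *\<^sub>R ((1 - a \<bullet> a) *\<^sub>R z + (2 * (1 + a \<bullet> z)) *\<^sub>R a)"

lemma boost_denominator_pos:
  fixes a u :: "'a::real_inner"
  assumes "norm a < 1" "norm u = 1"
  shows "0 < 1 + a \<bullet> a + 2 * (a \<bullet> u)"
proof -
  have "\<bar>a \<bullet> u\<bar> \<le> norm a"
    using Cauchy_Schwarz_ineq2[of a u] assms by simp
  moreover have "0 < (1 - norm a)\<^sup>2"
    using assms by simp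
  moreover have "(1 - norm a)\<^sup>2 = 1 + a \<bullet> a - 2 * norm a"
    by (simp add: power2_diff power2_norm_eq_inner)
  ultimately show ?thesis
    by linarith
qed

lemma norm_boost:
  fixes a u :: "'a::real_inner"
  assumes "norm a < 1" "norm u = 1"
  shows "norm (boost a u) = 1"
proof -
  define d where "d = 1 + a \<bullet> a + 2 * (a \<bullet> u)"
  define w where "w = (1 - a \<bullet> a) *\<^sub>R u + (2 * (1 + a \<bullet> u)) *\<^sub>R a"
  have d: "d > 0"
    using boost_denominator_pos[OF assms] by (simp add: d_def)
  have "u \<bullet> u = 1"
    using assms by (simp add: norm_eq_1)
  then have "w \<bullet> w = d\<^sup>2"
    unfolding w_def d_def
    by (simp add: inner_add_left inner_add_right inner_commute[of u a]) (simp add: power2_eq_square algebra_simps)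
  then have "norm w = d"
    using d by (simp add: norm_eq_sqrt_inner)
  moreover have "boost a u = (1 / d) *\<^sub>R w"
    by (simp only: boost_def d_def w_def)
  ultimately show ?thesis
    using d by simp
qed

text \<open>
  The formula defines a projective transformation of the whole space, and the one for \<open>- a\<close> is its
  inverse: the two denominators multiply to \<open>(1 - a \<bullet> a)\<^sup>2\<close>.
\<close>

lemma boost_boost_uminus:
  fixes a u :: "'a::real_inner"
  assumes "norm a < 1" "norm u = 1"
  shows "boost (- a) (boost a u) = u"
proof -
  define N where "N = a \<bullet> a"
  define x where "x = a \<bullet> u"
  define d where "d = 1 + N + 2 * x"
  have d: "d > 0"
    using boost_denominator_pos[OF assms] by (simp add: d_def N_def x_def)
  have N: "N < 1"
    using assms by (simp add: N_def norm_lt_square power2_eq_square flip: power2_norm_eq_inner)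
  have b: "boost a u = (1/d) *\<^sub>R ((1 - N) *\<^sub>R u + (2 * (1 + x)) *\<^sub>R a)"
    by (simp add: boost_def d_def N_def x_def)
  have ab: "a \<bullet> boost a u = (x + N * x + 2 * N) / d"
    unfolding b using d by (simp add: inner_add_right flip: N_def x_def) (simp add: field_simps)
  have d': "1 + N - 2 * ((x + N * x + 2 * N) / d) = (1 - N)\<^sup>2 / d"
    using d by (simp add: field_simps) (simp add: d_def power2_eq_square algebra_simps)
  have e': "1 - (x + N * x + 2 * N) / d = (1 - N) * (1 + x) / d"
    using d by (simp add: field_simps) (simp add: d_def algebra_simps)
  have "boost (- a) (boost a u) = (1 / ((1 - N)\<^sup>2 / d)) *\<^sub>R ((1 - N) *\<^sub>R boost a u - (2 * ((1 - N) * (1 + x) / d)) *\<^sub>R a)"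
    unfolding boost_def[of "- a"] by (simp add: ab flip: N_def d' e')
  also have "(1 - N) *\<^sub>R boost a u - (2 * ((1 - N) * (1 + x) / d)) *\<^sub>R a = ((1 - N)\<^sup>2 / d) *\<^sub>R u"
    unfolding b by (simp add: scaleR_add_right power2_eq_square mult.commute)
  finally show ?thesis
    using d N by simp
qed

definition boost_deriv :: "'a::real_inner \<Rightarrow> 'a \<Rightarrow> 'a \<Rightarrow> 'a" where
  "boost_deriv a u v = (1 / (1 + a \<bullet> a + 2 * (a \<bullet> u))) *\<^sub>R
     ((1 - a \<bullet> a) *\<^sub>R v + (2 * (a \<bullet> v)) *\<^sub>R a - (2 * (a \<bullet> v)) *\<^sub>R boost a u)"

lemma has_derivative_boost:
  fixes a u :: "'a::real_inner"
  assumes "1 + a \<bullet> a + 2 * (a \<bullet> u) \<noteq> 0"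
  shows "(boost a has_derivative boost_deriv a u) (at u)"
proof -
  let ?d = "\<lambda>z. 1 + a \<bullet> a + 2 * (a \<bullet> z)"
  let ?w = "\<lambda>z. (1 - a \<bullet> a) *\<^sub>R z + (2 * (1 + a \<bullet> z)) *\<^sub>R a"
  have d: "(?d has_derivative (\<lambda>v. 2 * (a \<bullet> v))) (at u)"
    by (auto intro!: derivative_eq_intros)
  have w: "(?w has_derivative (\<lambda>v. (1 - a \<bullet> a) *\<^sub>R v + (2 * (a \<bullet> v)) *\<^sub>R a)) (at u)"
    by (auto intro!: derivative_eq_intros)
  have "((\<lambda>z. inverse (?d z) *\<^sub>R ?w z) has_derivative
     (\<lambda>v. inverse (?d u) *\<^sub>R ((1 - a \<bullet> a) *\<^sub>R v + (2 * (a \<bullet> v)) *\<^sub>R a) +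
       (- (inverse (?d u) * (2 * (a \<bullet> v)) * inverse (?d u))) *\<^sub>R ?w u)) (at u)"
    by (intro has_derivative_scaleR Deriv.has_derivative_inverse[OF assms d] w)
  moreover have "boost a = (\<lambda>z. inverse (?d z) *\<^sub>R ?w z)"
    by (simp add: boost_def[abs_def] inverse_eq_divide)
  moreover have "boost_deriv a u = (\<lambda>v. inverse (?d u) *\<^sub>R ((1 - a \<bullet> a) *\<^sub>R v + (2 * (a \<bullet> v)) *\<^sub>R a) +
       (- (inverse (?d u) * (2 * (a \<bullet> v)) * inverse (?d u))) *\<^sub>R ?w u)"
    by (rule ext) (simp only: boost_deriv_def boost_def scaleR_diff_right scaleR_scaleR inverse_eq_divide,
        simp add: ac_simps)
  ultimately show ?thesis
    by simp
qed

text \<open>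
  The homogeneous extension of the boost to the whole space is not given by a continuous formula at
  the origin; there continuity follows since the boost preserves norms.
\<close>

lemma continuous_on_boost_sgn:
  fixes c f :: "'b::topological_space \<Rightarrow> 'a::real_inner"
  assumes c: "continuous_on S c" and f: "continuous_on S f" and c1: "\<And>x. x \<in> S \<Longrightarrow> norm (c x) < 1"
  shows "continuous_on S (\<lambda>x. norm (f x) *\<^sub>R boost (c x) (sgn (f x)))"
  unfolding continuous_on_def
proof
  fix x assume x: "x \<in> S"
  have cx: "(c \<longlongrightarrow> c x) (at x within S)" and fx: "(f \<longlongrightarrow> f x) (at x within S)"
    using c f x by (auto simp: continuous_on_def)
  show "((\<lambda>x. norm (f x) *\<^sub>R boost (c x) (sgn (f x))) \<longlongrightarrow> norm (f x) *\<^sub>R boost (c x) (sgn (f x))) (at x within S)"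
  proof (cases "f x = 0")
    case False
    then have "1 + c x \<bullet> c x + 2 * (c x \<bullet> sgn (f x)) \<noteq> 0"
      using boost_denominator_pos[OF c1[OF x], of "sgn (f x)"] by (simp add: norm_sgn)
    then show ?thesis
      unfolding boost_def by (intro tendsto_intros cx fx False)
  next
    case True
    have "norm (norm (f y) *\<^sub>R boost (c y) (sgn (f y))) \<le> norm (f y)" if "y \<in> S" for y
      using norm_boost[OF c1[OF that], of "sgn (f y)"] by (cases "f y = 0") (auto simp: norm_sgn)
    then have "\<forall>\<^sub>F y in at x within S. norm (norm (f y) *\<^sub>R boost (c y) (sgn (f y))) \<le> norm (f y)"
      by (auto simp: eventually_at_filter)
    moreover have "((\<lambda>y. norm (f y)) \<longlongrightarrow> 0) (at x within S)"
      using fx True by (simp add: tendsto_norm_zero)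
    ultimately show ?thesis
      using True by (simp add: Lim_null_comparison)
  qed
qed

lemma boost_curve_has_vector_derivative:
  fixes g :: "real \<Rightarrow> 'a::real_inner"
  assumes "norm a < 1" "norm (g t) = 1" "(g has_vector_derivative v) (at t)"
  shows "((\<lambda>t. boost a (g t)) has_vector_derivative boost_deriv a (g t) v) (at t)"
proof -
  have "1 + a \<bullet> a + 2 * (a \<bullet> g t) \<noteq> 0"
    using boost_denominator_pos[OF assms(1,2)] by simp
  from has_derivative_at_withinI[OF has_derivative_boost[OF this]]
  show ?thesis
    using vector_derivative_diff_chain_within[OF assms(3), of "boost a" "boost_deriv a (g t)"]
    by (simp add: o_def)
qed

lemma linear_boost_deriv:
  assumes "norm a < 1" "norm u = 1"
  shows "linear (boost_deriv a u)"
  using boost_denominator_pos[OF assms] by (intro has_derivative_linear[OF has_derivative_boost]) simp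

text \<open>
  Along a spherical curve the boosts by \<open>a\<close> and \<open>- a\<close> cancel, hence so do their derivatives. This is how
  regularity of curves and transversality of crossings are transported: the derivative of the inverse
  boost is a linear map taking the new velocities back to the old ones.
\<close>

lemma boost_deriv_boost_deriv_uminus:
  fixes g :: "real \<Rightarrow> 'a::real_inner"
  assumes a: "norm a < 1" and g: "\<And>t. norm (g t) = 1" and v: "(g has_vector_derivative v) (at t)"
  shows "boost_deriv (- a) (boost a (g t)) (boost_deriv a (g t) v) = v"
proof -
  have "((\<lambda>t. boost (- a) (boost a (g t))) has_vector_derivative
      boost_deriv (- a) (boost a (g t)) (boost_deriv a (g t) v)) (at t)"
    by (intro boost_curve_has_vector_derivative v a) (simp_all add: norm_boost a g)
  then have "(g has_vector_derivative boost_deriv (- a) (boost a (g t)) (boost_deriv a (g t) v)) (at t)"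
    by (simp add: boost_boost_uminus a g)
  then show ?thesis
    using v vector_derivative_unique_at by blast
qed

lemma regular_spherical_closed_curve_boost:
  assumes a: "norm a < 1" and g: "regular_spherical_closed_curve g"
  shows "regular_spherical_closed_curve (\<lambda>t. boost a (g t))"
proof -
  let ?v = "\<lambda>t. vector_derivative g (at t)"
  have g1: "norm (g t) = 1" for t
    using g by (simp add: regular_spherical_closed_curve_def)
  have C1: "g C1_differentiable_on UNIV"
    using g by (simp add: regular_spherical_closed_curve_def)
  then have dv: "(g has_vector_derivative ?v t) (at t)" for t
    by (simp add: C1_differentiable_on_eq vector_derivative_works)
  have cv: "continuous_on UNIV ?v"
    using C1 by (simp add: C1_differentiable_on_eq)
  have cg: "continuous_on UNIV g"
    using dv by (meson continuous_at_imp_continuous_on has_vector_derivative_continuous)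
  have D: "((\<lambda>t. boost a (g t)) has_vector_derivative boost_deriv a (g t) (?v t)) (at t)" for t
    using boost_curve_has_vector_derivative[OF a g1 dv] .
  have "1 + a \<bullet> a + 2 * (a \<bullet> g t) \<noteq> 0" for t
    using boost_denominator_pos[OF a g1[of t]] by simp
  then have "continuous_on UNIV (\<lambda>t. boost_deriv a (g t) (?v t))"
    unfolding boost_deriv_def boost_def by (intro continuous_intros cg cv) auto
  with D have "(\<lambda>t. boost a (g t)) C1_differentiable_on UNIV"
    unfolding C1_differentiable_on_def
    by (intro exI[of _ "\<lambda>t. boost_deriv a (g t) (?v t)"]) simp
  moreover have "vector_derivative (\<lambda>t. boost a (g t)) (at t) \<noteq> 0" for t
  proof
    assume "vector_derivative (\<lambda>t. boost a (g t)) (at t) = 0"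
    then have "boost_deriv a (g t) (?v t) = 0"
      using vector_derivative_at[OF D] by simp
    then have "?v t = 0"
      using boost_deriv_boost_deriv_uminus[OF a g1 dv, of t]
        linear_0[OF linear_boost_deriv[of "- a" "boost a (g t)"]] by (simp add: a norm_boost g1)
    then show False
      using g by (simp add: regular_spherical_closed_curve_def)
  qed
  ultimately show ?thesis
    using g by (simp add: regular_spherical_closed_curve_def norm_boost a)
qed

text \<open>
  Let \<open>x = b \<bullet> u\<close>. The image \<open>w\<close> of \<open>u\<close> satisfies
  \<open>\<bar>w - b\<bar>\<^sup>2 = 2 (1 - s)\<^sup>2 (1 - x) / ((1 - s)\<^sup>2 + 2 s (1 + x))\<close>. By compactness \<open>1 + x\<close> is bounded away
  from \<open>0\<close> on \<open>K\<close>, because the repelling point \<open>- b\<close> is not in \<open>K\<close>. So the distance goes to \<open>0\<close>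
  uniformly on \<open>K\<close>.
\<close>

lemma boost_contracts:
  fixes b :: "'a::euclidean_space"
  assumes K: "compact K" "K \<subseteq> sphere 0 1" and b: "norm b = 1" "- b \<notin> K" and \<delta>: "\<delta> > 0"
  shows "\<forall>\<^sub>F s in at_left (1::real). \<forall>u\<in>K. dist (boost (s *\<^sub>R b) u) b < \<delta>"
proof (cases "K = {}")
  case False
  have bb: "b \<bullet> b = 1"
    using b by (simp add: norm_eq_1)
  have "continuous_on K (\<lambda>u. b \<bullet> u)"
    by (intro continuous_intros)
  from continuous_attains_inf[OF K(1) False this]
  obtain u0 where u0: "u0 \<in> K" "\<And>u. u \<in> K \<Longrightarrow> b \<bullet> u0 \<le> b \<bullet> u"
    by blast
  define \<epsilon> where "\<epsilon> = 1 + b \<bullet> u0"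
  have "0 < norm (b + u0)"
    using u0 b by (metis add.commute eq_neg_iff_add_eq_0 zero_less_norm_iff neg_eq_iff_add_eq_0)
  then have "0 < (b + u0) \<bullet> (b + u0)"
    by simp
  moreover have "u0 \<bullet> u0 = 1"
    using u0 K by (auto simp: norm_eq_1)
  ultimately have \<epsilon>: "\<epsilon> > 0"
    by (simp add: \<epsilon>_def inner_add_left inner_add_right bb inner_commute[of u0 b])
  have "((\<lambda>s::real. 4 * (1 - s)\<^sup>2 / \<epsilon>) \<longlongrightarrow> 4 * (1 - 1)\<^sup>2 / \<epsilon>) (at_left 1)"
    by (intro tendsto_intros) (use \<epsilon> in auto)
  then have "\<forall>\<^sub>F s in at_left (1::real). 4 * (1 - s)\<^sup>2 / \<epsilon> < \<delta>\<^sup>2"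
    by (rule order_tendstoD) (use \<delta> in auto)
  moreover have "\<forall>\<^sub>F s in at_left (1::real). 1/2 < s"
    by (rule order_tendstoD[OF tendsto_ident_at]) auto
  moreover have "\<forall>\<^sub>F s in at_left (1::real). s < 1"
    by (simp add: eventually_at_filter)
  ultimately show ?thesis
  proof eventually_elim
    case (elim s)
    show ?case
    proof
      fix u assume u: "u \<in> K"
      define x where "x = b \<bullet> u"
      define d where "d = 1 + s\<^sup>2 + 2 * s * x"
      have u1: "norm u = 1"
        using u K by auto
      have s1: "norm (s *\<^sub>R b) < 1"
        using elim b by simp
      have x: "\<epsilon> \<le> 1 + x" "x \<ge> -1"
        using u0(2)[OF u] \<epsilon> by (auto simp: x_def \<epsilon>_def)
      have "d = (1 - s)\<^sup>2 + 2 * s * (1 + x)"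
        by (simp add: d_def power2_diff algebra_simps)
      moreover have "\<epsilon> \<le> 2 * s * (1 + x)"
        using mult_mono[of 1 "2 * s" \<epsilon> "1 + x"] elim x \<epsilon> by simp
      ultimately have d_ge: "\<epsilon> \<le> d"
        by (smt (verit) zero_le_power2)
      have dp: "d > 0"
        using d_ge \<epsilon> by simp
      have y: "boost (s *\<^sub>R b) u \<bullet> b = ((1 - s\<^sup>2) * x + 2 * (1 + s * x) * s) / d"
        by (simp add: boost_def inner_add_left bb x_def d_def inner_commute[of u b] power2_eq_square mult.assoc)
      have dist_sq: "(dist w b)\<^sup>2 = 2 - 2 * (w \<bullet> b)" if "norm w = 1" for w
        using that bb by (simp add: dist_norm power2_norm_eq_inner norm_eq_1 inner_diff_left inner_diff_right inner_commute)
      have "(dist (boost (s *\<^sub>R b) u) b)\<^sup>2 = 2 - 2 * (boost (s *\<^sub>R b) u \<bullet> b)"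
        by (rule dist_sq[OF norm_boost[OF s1 u1]])
      also have "\<dots> = 2 * (1 - s)\<^sup>2 * (1 - x) / d"
      proof -
        have "d - ((1 - s\<^sup>2) * x + 2 * (1 + s * x) * s) = (1 - s)\<^sup>2 * (1 - x)"
          by (simp add: d_def power2_eq_square algebra_simps)
        then have "1 - (boost (s *\<^sub>R b) u \<bullet> b) = (1 - s)\<^sup>2 * (1 - x) / d"
          unfolding y using dp by (metis diff_divide_distrib divide_self less_irrefl)
        then show ?thesis
          by simp
      qed
      also have "\<dots> \<le> 2 * (1 - s)\<^sup>2 * 2 / \<epsilon>"
        using x d_ge \<epsilon> by (intro frac_le mult_left_mono) auto
      also have "\<dots> < \<delta>\<^sup>2"
        using elim by simp
      finally show "dist (boost (s *\<^sub>R b) u) b < \<delta>"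
        using \<delta> by (simp add: power_less_imp_less_base)
    qed
  qed
qed simp

section \<open>Isotopies preserving concentric spheres\<close>

text \<open>
  A boost preserves the concentric spheres, so different spheres may be moved by different boosts, as
  long as the parameter depends continuously on the radius. Scaling the parameter by \<open>t\<close> from 0 to 1
  gives the isotopy; each stage is inverted by the stage with the opposite parameters.
\<close>

lemma ambient_isotopic_twist:
  fixes c :: "real \<Rightarrow> real^3"
  assumes c: "continuous_on UNIV c" "\<And>r. norm (c r) < 1"
  shows "ambient_isotopic L ((\<lambda>z. norm z *\<^sub>R boost (c (norm z)) (sgn z)) ` L)"
proof -
  define T where "T = (\<lambda>(t::real) z. norm z *\<^sub>R boost (t *\<^sub>R c (norm z)) (sgn z))"
  have small: "norm (t *\<^sub>R c r) < 1" if "\<bar>t\<bar> \<le> 1" for t r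
    using mult_left_le_one_le[of "norm (c r)" "\<bar>t\<bar>"] c(2)[of r] that by simp
  have cont: "continuous_on S (\<lambda>x. T (f x) (h x))"
    if "continuous_on S f" "continuous_on S h" "\<And>x. x \<in> S \<Longrightarrow> \<bar>f x\<bar> \<le> 1"
    for S :: "'c::topological_space set" and f h
  proof -
    have "continuous_on S (\<lambda>x. c (norm (h x)))"
      by (rule continuous_on_compose2[OF c(1)]) (auto intro!: continuous_intros that)
    then show ?thesis
      unfolding T_def by (intro continuous_on_boost_sgn continuous_on_scaleR that small)
  qed
  have norm_T: "norm (T t z) = norm z" if "\<bar>t\<bar> \<le> 1" for t z
    using norm_boost[OF small[OF that], of "sgn z"] by (cases "z = 0") (auto simp: T_def norm_sgn)
  have sgn_T: "sgn (T t z) = boost (t *\<^sub>R c (norm z)) (sgn z)" if "\<bar>t\<bar> \<le> 1" "z \<noteq> 0" for t z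
    using norm_boost[OF small[OF that(1)], of "sgn z" "norm z"] that by (simp add: T_def norm_sgn sgn_div_norm)
  have inv: "T (- t) (T t z) = z" if "\<bar>t\<bar> \<le> 1" for t z
  proof (cases "z = 0")
    case False
    have "T (- t) (T t z) = norm (T t z) *\<^sub>R boost (- t *\<^sub>R c (norm (T t z))) (sgn (T t z))"
      by (simp only: T_def)
    also have "\<dots> = norm z *\<^sub>R boost (- (t *\<^sub>R c (norm z))) (boost (t *\<^sub>R c (norm z)) (sgn z))"
      by (simp only: norm_T[OF that] sgn_T[OF that False] scaleR_minus_left)
    also have "\<dots> = norm z *\<^sub>R sgn z"
      using False by (simp add: boost_boost_uminus[OF small[OF that]] norm_sgn)
    finally show ?thesis
      using False by (simp add: sgn_div_norm)
  qed (simp add: T_def)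
  have homeo: "homeomorphism UNIV UNIV (T t) (T (- t))" if "\<bar>t\<bar> \<le> 1" for t
  proof (rule homeomorphismI)
    show "continuous_on UNIV (T t)" "continuous_on UNIV (T (- t))"
      using cont[of UNIV "\<lambda>_. t" "\<lambda>z. z"] cont[of UNIV "\<lambda>_. - t" "\<lambda>z. z"] that by auto
  qed (use inv[of t] inv[of "- t"] that in auto)
  have "homotopic_with_canon (\<lambda>f. \<exists>g. homeomorphism UNIV UNIV f g) UNIV UNIV id (T 1)"
    unfolding homotopic_with_def
  proof (intro exI conjI ballI allI)
    show "continuous_map (prod_topology (top_of_set {0..1::real}) (top_of_set UNIV)) (top_of_set UNIV)
        (\<lambda>p. T (fst p) (snd p))"
      unfolding prod_topology_subtopology_eu continuous_map_subtopology_eu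
      by (intro conjI cont) (auto intro!: continuous_intros)
    show "(\<lambda>p. T (fst p) (snd p)) (0, z) = id z" for z
      by (cases "z = 0") (auto simp: T_def boost_def sgn_div_norm)
    show "homeomorphism UNIV UNIV (\<lambda>z. T (fst (t, z)) (snd (t, z))) (T (- t))" if "t \<in> {0..1}" for t
      using homeo[of t] that by simp
  qed simp
  moreover have "T 1 = (\<lambda>z. norm z *\<^sub>R boost (c (norm z)) (sgn z))"
    by (simp add: T_def)
  ultimately show ?thesis
    unfolding ambient_isotopic_def by (intro exI[of _ "T 1"] conjI) simp_all
qed

section \<open>Curves on the sphere, radii and parameters\<close>

text \<open>
  The cone is a smooth image of a plane in 3-space. This is used to see that curves cannot fill the
  sphere: the whole space is the cone over the sphere.
\<close>

lemma negligible_cone_over_curve: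
  fixes g :: "real \<Rightarrow> real^3"
  assumes "g C1_differentiable_on UNIV"
  shows "negligible (range (\<lambda>p :: real \<times> real. fst p *\<^sub>R g (snd p)))"
proof (rule negligible_differentiable_image_lowdim)
  show "(\<lambda>p :: real \<times> real. fst p *\<^sub>R g (snd p)) differentiable_on UNIV"
    unfolding differentiable_on_def
  proof
    fix p :: "real \<times> real"
    have "g differentiable (at (snd p))"
      using assms by (simp add: C1_differentiable_on_eq)
    then obtain g' where g': "(g has_derivative g') (at (snd p))"
      by (auto simp: differentiable_def)
    have "((\<lambda>p. g (snd p)) has_derivative (\<lambda>h. g' (snd h))) (at p)"
      by (rule has_derivative_compose[OF has_derivative_snd[OF has_derivative_ident] g'])
    from has_derivative_scaleR[OF has_derivative_fst[OF has_derivative_ident] this]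
    show "(\<lambda>p. fst p *\<^sub>R g (snd p)) differentiable (at p)"
      by (rule differentiableI)
  qed
  show "DIM(real \<times> real) < DIM(real^3)"
    by simp
qed

text \<open>
  These will be the attracting points of the boosts for the various components. They have to be
  distinct so that the shrunken components lie in disjoint discs, and their antipodes, the repelling
  points, have to avoid the curves. If only finitely many points of the sphere lay off the curves,
  then the cones over the curves and finitely many lines would cover the space.
\<close>

lemma distinct_points_off_curves:
  fixes g :: "nat \<Rightarrow> real \<Rightarrow> real^3"
  assumes "\<And>i. i < n \<Longrightarrow> g i C1_differentiable_on UNIV"
  shows "\<exists>b :: nat \<Rightarrow> real^3. inj b \<and> (\<forall>i. norm (b i) = 1) \<and> (\<forall>i. \<forall>j<n. - b i \<notin> range (g j))"
proof -
  define V where "V = sphere 0 1 - (\<Union>j<n. range (g j))"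
  have "infinite V"
  proof
    assume fin: "finite V"
    let ?C = "\<lambda>j. range (\<lambda>p :: real \<times> real. fst p *\<^sub>R g j (snd p))"
    have "negligible ((\<Union>j<n. ?C j) \<union> (\<Union>v\<in>insert 0 V. span {v}))"
    proof (intro negligible_Un negligible_Union finite_imageI finite_lessThan finite.insertI fin)
      show "negligible X" if "X \<in> (\<lambda>v. span {v}) ` insert 0 V" for X :: "(real^3) set"
      proof -
        have "dim (span {v}) < DIM(real^3)" for v :: "real^3"
          using dim_le_card'[of "{v}"] by simp
        then show ?thesis
          using that negligible_lowdim by blast
      qed
    qed (use assms negligible_cone_over_curve in blast)
    moreover have "z \<in> (\<Union>j<n. ?C j) \<union> (\<Union>v\<in>insert 0 V. span {v})" for z
    proof (cases "z = 0")
      case False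
      have z: "z = norm z *\<^sub>R sgn z"
        using False by (simp add: sgn_div_norm)
      show ?thesis
      proof (cases "sgn z \<in> V")
        case True
        then have "z \<in> span {sgn z}"
          by (metis z insertI1 span_base span_mul)
        with True show ?thesis
          by blast
      next
        case not_V: False
        have "norm (sgn z) = 1"
          using False by (simp add: norm_sgn)
        then obtain j t where "j < n" "sgn z = g j t"
          using not_V by (auto simp: V_def)
        then have "z = fst (norm z, t) *\<^sub>R g j (snd (norm z, t))"
          using z by simp
        with \<open>j < n\<close> show ?thesis
          by blast
      qed
    qed simp
    ultimately show False
      using negligible_subset[of _ "UNIV :: (real^3) set"] non_negligible_UNIV by blast
  qed
  then obtain f :: "nat \<Rightarrow> real^3" where f: "inj f" "range f \<subseteq> V"
    using infinite_countable_subset by blast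
  show ?thesis
  proof (intro exI[of _ "\<lambda>i. - f i"] conjI allI impI)
    show "inj (\<lambda>i. - f i)"
      using f(1) by (simp add: inj_on_def)
    show "norm (- f i) = 1" "j < n \<Longrightarrow> - (- f i) \<notin> range (g j)" for i j
      using subsetD[OF f(2) rangeI[of f i]] by (auto simp: V_def)
  qed
qed

text \<open>
  This serves to lower a component exactly at its under-passages: being the lowest possible there, and
  only there, is a way to realise all self-crossings at once.
\<close>

lemma periodic_C1_function_with_zeros:
  fixes U :: "real set"
  assumes U: "finite U" "U \<subseteq> {0..<1}"
  shows "\<exists>f :: real \<Rightarrow> real. f C1_differentiable_on UNIV \<and> (\<forall>t. f (t + 1) = f t) \<and>
    (\<forall>t. 0 \<le> f t \<and> f t \<le> 1) \<and> (\<forall>t\<in>{0..<1}. f t = 0 \<longleftrightarrow> t \<in> U)"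
proof (intro exI conjI allI ballI)
  let ?f = "\<lambda>t. \<Prod>s\<in>U. (sin (pi * (t - s)))\<^sup>2"
  show "?f C1_differentiable_on UNIV"
    using U(1)
  proof (induction U)
    case (insert s U)
    have "(\<lambda>t. (sin (pi * (t - s)))\<^sup>2) C1_differentiable_on UNIV"
      unfolding C1_differentiable_on_def
      by (intro exI[of _ "\<lambda>t. 2 * sin (pi * (t - s)) * (cos (pi * (t - s)) * pi)"] conjI ballI)
        (auto intro!: derivative_eq_intros continuous_intros
          simp flip: has_real_derivative_iff_has_vector_derivative)
    with insert show ?case
      by (simp add: C1_differentiable_on_mult)
  qed simp
  show "?f (t + 1) = ?f t" for t
  proof (intro prod.cong refl)
    fix s
    have "sin (pi * (t + 1 - s)) = sin (pi * (t - s) + pi)"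
      by (simp add: algebra_simps)
    then show "(sin (pi * (t + 1 - s)))\<^sup>2 = (sin (pi * (t - s)))\<^sup>2"
      by simp
  qed
  show "0 \<le> ?f t" for t
    by (simp add: prod_nonneg)
  show "?f t \<le> 1" for t
    by (intro prod_le_1) (simp add: abs_square_le_1)
  show "?f t = 0 \<longleftrightarrow> t \<in> U" if t: "t \<in> {0..<1}" for t
  proof -
    have "sin (pi * (t - s)) = 0 \<longleftrightarrow> t = s" if "s \<in> U" for s
    proof
      assume "sin (pi * (t - s)) = 0"
      then obtain k :: int where "t - s = of_int k"
        by (auto simp: sin_zero_iff_int2)
      moreover have "\<bar>t - s\<bar> < 1"
        using t that U(2) by force
      ultimately have "k = 0"
        by linarith
      with \<open>t - s = of_int k\<close> show "t = s"
        by simp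
    qed simp
    then show ?thesis
      using U(1) by auto
  qed
qed

text \<open>
  This produces the dependence of the boost on the radius: the spherical shell of radii at distance at
  most 1/4 from \<open>m i\<close> holds one component and is moved by the single boost \<open>b i\<close>. The plateaus
  are joined by linear interpolation with the value 0, at distance 1/2 from the centres of the shells.
\<close>

lemma continuous_function_with_plateaus:
  fixes m :: "'b \<Rightarrow> nat" and b :: "'b \<Rightarrow> 'a::real_normed_vector"
  assumes I: "finite I" and m: "inj_on m I" and b: "\<And>i. i \<in> I \<Longrightarrow> norm (b i) \<le> s" and s: "0 \<le> s"
  shows "\<exists>c. continuous_on UNIV c \<and> (\<forall>r. norm (c r) \<le> s) \<and>
    (\<forall>i\<in>I. \<forall>r. \<bar>r - real (m i)\<bar> \<le> 1/4 \<longrightarrow> c r = b i)"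
proof (intro exI conjI ballI allI impI)
  let ?p = "\<lambda>x::real. max 0 (min 1 (2 - 4 * \<bar>x\<bar>))"
  let ?c = "\<lambda>r. \<Sum>i\<in>I. ?p (r - real (m i)) *\<^sub>R b i"
  show "continuous_on UNIV ?c"
    by (intro continuous_intros)
  have only: "?c r = ?p (r - real (m i)) *\<^sub>R b i" if i: "i \<in> I" and r: "\<bar>r - real (m i)\<bar> < 1/2" for i r
  proof -
    have "?p (r - real (m j)) *\<^sub>R b j = 0" if "j \<in> I - {i}" for j
    proof -
      have "m j \<noteq> m i"
        using m i that by (auto dest: inj_onD)
      then have "\<bar>real (m j) - real (m i)\<bar> \<ge> 1"
        by linarith
      then have "2 - 4 * \<bar>r - real (m j)\<bar> \<le> 0"
        using r abs_triangle_ineq4[of "r - real (m i)" "r - real (m j)"] by simp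
      then show ?thesis
        by simp
    qed
    then show ?thesis
      by (subst sum.remove[OF I i]) (simp add: sum.neutral)
  qed
  show "norm (?c r) \<le> s" for r
  proof (cases "\<exists>i\<in>I. \<bar>r - real (m i)\<bar> < 1/2")
    case True
    then obtain i where i: "i \<in> I" "\<bar>r - real (m i)\<bar> < 1/2"
      by blast
    have "\<bar>?p (r - real (m i))\<bar> * norm (b i) \<le> 1 * s"
      by (intro mult_mono b i) auto
    then show ?thesis
      unfolding only[OF i] by simp
  next
    case False
    then have "?p (r - real (m i)) *\<^sub>R b i = 0" if "i \<in> I" for i
      using that by (auto simp: not_less max_def min_def)
    then show ?thesis
      using s by (simp add: sum.neutral)
  qed
  show "?c r = b i" if "i \<in> I" "\<bar>r - real (m i)\<bar> \<le> 1/4" for i r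
    using only[of i r] that by simp
qed

section \<open>Moving the components of a diagram apart\<close>

lemma collinear_linear_image:
  assumes "linear f" "collinear S"
  shows "collinear (f ` S)"
proof -
  obtain u where u: "\<And>x y. x \<in> S \<Longrightarrow> y \<in> S \<Longrightarrow> \<exists>k. x - y = k *\<^sub>R u"
    using assms(2) unfolding collinear_def by blast
  have "\<exists>k. f x - f y = k *\<^sub>R f u" if "x \<in> S" "y \<in> S" for x y
    using u[OF that] by (metis assms(1) linear_diff linear_scale)
  then show ?thesis
    unfolding collinear_def by blast
qed

text \<open>
  When the boosts push the components apart, only self-crossings survive; hence an under-passage is
  kept only if all strands through its point belong to one component.
\<close>

definition boost_components :: "(nat \<Rightarrow> real^3) \<Rightarrow> diagram \<Rightarrow> diagram" where
  "boost_components c D = D\<lparr>curve := \<lambda>i t. boost (c i) (curve D i t),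
     underpasses := {x \<in> underpasses D. \<forall>y\<in>strands_at D (point_at D x). fst y = fst x}\<rparr>"

lemma boost_components_simps [simp]:
  "num_components (boost_components c D) = num_components D"
  "passages (boost_components c D) = passages D"
  "curve (boost_components c D) = (\<lambda>i t. boost (c i) (curve D i t))"
  "point_at (boost_components c D) x = boost (c (fst x)) (point_at D x)"
  "underpasses (boost_components c D) =
     {x \<in> underpasses D. \<forall>y\<in>strands_at D (point_at D x). fst y = fst x}"
  by (simp_all add: boost_components_def passages_def point_at_def)

lemma norm_point_at:
  assumes "link_diagram D" "x \<in> passages D"
  shows "norm (point_at D x) = 1"
  using assms by (auto simp: link_diagram_def passages_def point_at_def regular_spherical_closed_curve_def)

context
  fixes D :: diagram and c :: "nat \<Rightarrow> real^3"
  assumes D: "link_diagram D"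
    and c: "\<And>i. i < num_components D \<Longrightarrow> norm (c i) < 1"
    and apart: "\<And>i j s t. i < num_components D \<Longrightarrow> j < num_components D \<Longrightarrow> i \<noteq> j \<Longrightarrow>
        boost (c i) (curve D i s) \<noteq> boost (c j) (curve D j t)"
begin

lemma strands_at_boost_components:
  assumes x: "x \<in> passages D"
  shows "strands_at (boost_components c D) (point_at (boost_components c D) x) =
    {y \<in> strands_at D (point_at D x). fst y = fst x}"
proof -
  have "point_at (boost_components c D) y = point_at (boost_components c D) x \<longleftrightarrow>
      point_at D y = point_at D x \<and> fst y = fst x" if y: "y \<in> passages D" for y
  proof
    assume eq: "point_at (boost_components c D) y = point_at (boost_components c D) x"
    have i: "fst x < num_components D" "fst y < num_components D"
      using x y by (auto simp: passages_def)
    then have "fst y = fst x"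
      using eq apart[of "fst y" "fst x" "snd y" "snd x"] by (auto simp: point_at_def)
    moreover from this have "boost (- c (fst x)) (boost (c (fst x)) (point_at D y)) =
        boost (- c (fst x)) (boost (c (fst x)) (point_at D x))"
      using eq by simp
    then have "point_at D y = point_at D x"
      by (simp add: boost_boost_uminus c i norm_point_at D x y)
    ultimately show "point_at D y = point_at D x \<and> fst y = fst x"
      by simp
  qed simp
  then show ?thesis
    by (auto simp: strands_at_def)
qed

text \<open>
  Two strands remain at \<open>p\<close>, and there were at most two strands at the corresponding point of \<open>D\<close>; so
  none of them was lost, and that point was a self-crossing.
\<close>

lemma crossing_boost_componentsE:
  assumes p: "p \<in> crossings (boost_components c D)"
  obtains x where "x \<in> passages D" "p = boost (c (fst x)) (point_at D x)" "point_at D x \<in> crossings D"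
    "strands_at (boost_components c D) p = strands_at D (point_at D x)"
    "\<And>y. y \<in> strands_at D (point_at D x) \<Longrightarrow> fst y = fst x"
proof -
  have card: "card (strands_at (boost_components c D) p) = 2"
    using p by (simp add: crossings_def)
  then obtain x where x: "x \<in> strands_at (boost_components c D) p"
    by (metis card.empty ex_in_conv zero_neq_numeral)
  have xP: "x \<in> passages D" and px: "p = point_at (boost_components c D) x"
    using x by (auto simp: strands_at_def)
  have sub: "strands_at (boost_components c D) p = {y \<in> strands_at D (point_at D x). fst y = fst x}"
    unfolding px by (rule strands_at_boost_components[OF xP])
  have fin: "finite (strands_at D (point_at D x))" and le: "card (strands_at D (point_at D x)) \<le> 2"
    using D by (auto simp: link_diagram_def)
  have eq: "strands_at (boost_components c D) p = strands_at D (point_at D x)"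
  proof (rule card_subset_eq[OF fin])
    show "strands_at (boost_components c D) p \<subseteq> strands_at D (point_at D x)"
      using sub by blast
    from card_mono[OF fin this]
    show "card (strands_at (boost_components c D) p) = card (strands_at D (point_at D x))"
      using card le by linarith
  qed
  show thesis
  proof (rule that[OF xP _ _ eq])
    show "point_at D x \<in> crossings D"
      using eq card by (simp add: crossings_def)
    show "fst y = fst x" if "y \<in> strands_at D (point_at D x)" for y
      using that sub eq by blast
  qed (use px in simp)
qed

lemma nonself_crossings_boost_components: "nonself_crossings (boost_components c D) = {}"
proof -
  have False if p: "p \<in> crossings (boost_components c D)"
    and "i \<noteq> j" "strands_at (boost_components c D) p = {(i, s), (j, t)}" for p i j s t
    using crossing_boost_componentsE[OF p] that(2,3) by (metis fst_conv insertI1 insertI2)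
  then show ?thesis
    by (auto simp: nonself_crossings_def)
qed

lemma underpasses_boost_components:
  assumes x: "x \<in> underpasses (boost_components c D)"
  shows "x \<in> passages D \<and> point_at (boost_components c D) x \<in> crossings (boost_components c D)"
proof -
  have xD: "x \<in> passages D" "point_at D x \<in> crossings D"
    using D x by (auto simp: link_diagram_def)
  have "{y \<in> strands_at D (point_at D x). fst y = fst x} = strands_at D (point_at D x)"
    using x by auto
  then have "strands_at (boost_components c D) (point_at (boost_components c D) x) = strands_at D (point_at D x)"
    using strands_at_boost_components[OF xD(1)] by simp
  then show ?thesis
    using xD by (simp add: crossings_def)
qed

lemma card_underpasses_boost_components:
  assumes p: "p \<in> crossings (boost_components c D)"
  shows "card (strands_at (boost_components c D) p \<inter> underpasses (boost_components c D)) = 1"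
  using p
proof (rule crossing_boost_componentsE)
  fix x assume x: "point_at D x \<in> crossings D" "strands_at (boost_components c D) p = strands_at D (point_at D x)"
    "\<And>y. y \<in> strands_at D (point_at D x) \<Longrightarrow> fst y = fst x"
  have "strands_at (boost_components c D) p \<inter> underpasses (boost_components c D) = strands_at D (point_at D x) \<inter> underpasses D"
  proof -
    have "fst z = fst y" if "y \<in> strands_at D (point_at D x)" "z \<in> strands_at D (point_at D y)" for y z
      using that x(3)[of y] x(3)[of z] by (simp add: strands_at_def)
    then show ?thesis
      unfolding x(2) boost_components_simps by blast
  qed
  then show ?thesis
    using D x by (simp add: link_diagram_def)
qed

lemma link_diagram_boost_components: "link_diagram (boost_components c D)"
  unfolding link_diagram_def
proof (intro conjI allI impI ballI)
  let ?E = "boost_components c D"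
  show "0 < num_components ?E"
    using D by (simp add: link_diagram_def)
  show "regular_spherical_closed_curve (curve ?E i)" if "i < num_components ?E" for i
    using D that by (simp add: link_diagram_def regular_spherical_closed_curve_boost c)
  show "finite (strands_at ?E p)" "card (strands_at ?E p) \<le> 2" for p
  proof -
    have "finite (strands_at ?E p) \<and> card (strands_at ?E p) \<le> 2"
    proof (cases "strands_at ?E p = {}")
      case False
      then obtain x where "x \<in> passages D" "p = point_at ?E x"
        by (auto simp: strands_at_def)
      then have sub: "strands_at ?E p \<subseteq> strands_at D (point_at D x)"
        using strands_at_boost_components by blast
      have "finite (strands_at D (point_at D x))" "card (strands_at D (point_at D x)) \<le> 2"
        using D by (auto simp: link_diagram_def)
      with sub show ?thesis
        by (meson card_mono finite_subset le_trans)
    qed simp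
    then show "finite (strands_at ?E p)" "card (strands_at ?E p) \<le> 2"
      by auto
  qed
  show "finite (crossings ?E)"
  proof (rule finite_subset)
    show "crossings ?E \<subseteq> (\<Union>i<num_components D. boost (c i) ` crossings D)"
    proof
      fix p assume "p \<in> crossings ?E"
      then obtain x where "x \<in> passages D" "p = boost (c (fst x)) (point_at D x)" "point_at D x \<in> crossings D"
        by (rule crossing_boost_componentsE)
      then show "p \<in> (\<Union>i<num_components D. boost (c i) ` crossings D)"
        by (auto simp: passages_def)
    qed
    show "finite (\<Union>i<num_components D. boost (c i) ` crossings D)"
      using D by (simp add: link_diagram_def)
  qed
  show "\<not> collinear {0, velocity ?E x, velocity ?E y}"
    if "x \<in> passages ?E" "y \<in> passages ?E" and "x \<noteq> y \<and> point_at ?E x = point_at ?E y" for x y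
  proof
    from that have xy: "x \<in> passages ?E" "y \<in> passages ?E" "x \<noteq> y" "point_at ?E x = point_at ?E y"
      by auto
    assume col: "collinear {0, velocity ?E x, velocity ?E y}"
    have "y \<in> strands_at ?E (point_at ?E x)"
      using xy by (simp add: strands_at_def)
    then have same: "fst y = fst x" "point_at D y = point_at D x"
      using strands_at_boost_components[of x] xy by (auto simp: strands_at_def)
    define a where "a = c (fst x)"
    have a: "norm a < 1"
      using xy c by (auto simp: a_def passages_def)
    have reg: "regular_spherical_closed_curve (curve D (fst x))"
      using D xy by (auto simp: link_diagram_def passages_def)
    then have g1: "norm (curve D (fst x) t) = 1" for t
      by (simp add: regular_spherical_closed_curve_def)
    let ?w = "point_at ?E x"
    have vel: "boost_deriv (- a) ?w (velocity ?E z) = velocity D z"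
      if z: "fst z = fst x" "point_at D z = point_at D x" for z
    proof -
      have v: "(curve D (fst x) has_vector_derivative velocity D z) (at (snd z))"
        using reg z by (simp add: velocity_def regular_spherical_closed_curve_def C1_differentiable_on_eq
            flip: vector_derivative_works)
      have "velocity ?E z = boost_deriv a (curve D (fst x) (snd z)) (velocity D z)"
        using vector_derivative_at[OF boost_curve_has_vector_derivative[OF a g1 v]]
        by (simp add: velocity_def z a_def)
      then show ?thesis
        using boost_deriv_boost_deriv_uminus[OF a g1 v] z by (simp add: point_at_def a_def)
    qed
    have lin: "linear (boost_deriv (- a) ?w)"
      using norm_boost[OF a norm_point_at[OF D, of x]] xy by (intro linear_boost_deriv) (simp_all add: a flip: a_def)
    have "collinear (boost_deriv (- a) ?w ` {0, velocity ?E x, velocity ?E y})"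
      using col collinear_linear_image[OF lin] by blast
    then have "collinear {0, velocity D x, velocity D y}"
      using vel[of x] vel[of y] same linear_0[OF lin] by simp
    then show False
      using D xy same by (auto simp: link_diagram_def)
  qed
  show "underpasses ?E \<subseteq> {x \<in> passages ?E. point_at ?E x \<in> crossings ?E}"
    using underpasses_boost_components by (simp only: boost_components_simps(2)) blast
  show "card (strands_at ?E p \<inter> underpasses ?E) = 1" if "p \<in> crossings ?E" for p
    using card_underpasses_boost_components[OF that] .
qed

end

section \<open>Layered diagrams\<close>

lemma compact_range_periodic:
  fixes g :: "real \<Rightarrow> 'a::metric_space"
  assumes cont: "continuous_on UNIV g" and per: "\<And>t. g (t + 1) = g t"
  shows "compact (range g)"
proof -
  have "g t \<in> g ` {0..1}" for t
  proof -
    have "g (t + of_int k) = g t" for k t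
    proof (induction k rule: int_induct[of _ 0])
      case (step1 k)
      then show ?case
        using per[of "t + of_int k"] by (simp add: algebra_simps)
    next
      case (step2 k)
      then show ?case
        using per[of "t + of_int k - 1"] by (simp add: algebra_simps)
    qed simp
    from this[of "frac t" "\<lfloor>t\<rfloor>"] have "g t = g (frac t)"
      by (simp add: frac_def)
    moreover have "frac t \<in> {0..1}"
      using frac_lt_1[of t] by (simp add: less_imp_le)
    ultimately show ?thesis
      by blast
  qed
  then have "range g = g ` {0..1}"
    by auto
  then show ?thesis
    using cont by (metis compact_Icc compact_continuous_image continuous_on_subset top_greatest)
qed

text \<open>
  Put component \<open>i\<close> into the spherical shell of radii between \<open>m i + 1\<close> and \<open>m i + 1 + 1/4\<close>. Since the
  components are layered, this gives the right over/under information at the non-self crossings; at the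
  self-crossings it is achieved inside the shell by taking the minimal radius precisely at the
  under-passages. Now the shells are disjoint, so each component can be shrunk on the sphere to a
  small disc of its own by a boost of its shell, without any of them meeting another.
\<close>

lemma layered_diagram_completely_splittable:
  fixes m :: "nat \<Rightarrow> nat"
  assumes D: "link_diagram D"
    and m: "inj_on m {..<num_components D}"
    and layered: "\<And>p i j s t. p \<in> crossings D \<Longrightarrow> strands_at D p = {(i, s), (j, t)} \<Longrightarrow> i \<noteq> j \<Longrightarrow>
      (i, s) \<in> underpasses D \<Longrightarrow> m i < m j"
  shows "\<exists>L. diagram_of D L \<and> completely_splittable L"
proof -
  let ?n = "num_components D"
  have reg: "regular_spherical_closed_curve (curve D i)" if "i < ?n" for i
    using D that by (simp add: link_diagram_def)
  have C1: "curve D i C1_differentiable_on UNIV" if "i < ?n" for i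
    using reg[OF that] by (simp add: regular_spherical_closed_curve_def)
  have g1: "norm (curve D i t) = 1" if "i < ?n" for i t
    using reg[OF that] by (simp add: regular_spherical_closed_curve_def)
  have per: "curve D i (t + 1) = curve D i t" if "i < ?n" for i t
    using reg[OF that] by (simp add: regular_spherical_closed_curve_def)
  have "\<exists>b :: nat \<Rightarrow> real^3. inj b \<and> (\<forall>i. norm (b i) = 1) \<and> (\<forall>i. \<forall>j<?n. - b i \<notin> range (curve D j))"
    by (rule distinct_points_off_curves) (rule C1)
  then obtain b :: "nat \<Rightarrow> real^3" where b: "inj b" "\<forall>i. norm (b i) = 1"
      "\<forall>i. \<forall>j<?n. - b i \<notin> range (curve D j)"
    by (elim exE conjE)
  have compact: "compact (range (curve D i))" if "i < ?n" for i
    using C1_differentiable_imp_continuous_on[OF C1[OF that]] per[OF that] by (rule compact_range_periodic)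
  \<comment> \<open>If \<open>s\<close> is close to 1, both images lie within half the distance of \<open>b i\<close> and \<open>b j\<close> from these points.\<close>
  have separated: "\<forall>\<^sub>F s in at_left (1::real). \<forall>t t'. boost (s *\<^sub>R b i) (curve D i t) \<noteq> boost (s *\<^sub>R b j) (curve D j t')"
    if ij: "i < ?n" "j < ?n" "i \<noteq> j" for i j
  proof -
    define \<delta> where "\<delta> = dist (b i) (b j) / 2"
    have \<delta>: "\<delta> > 0"
      using b(1) ij by (auto simp: \<delta>_def dest: injD)
    have "\<forall>\<^sub>F s in at_left (1::real). \<forall>u\<in>range (curve D k). dist (boost (s *\<^sub>R b k) u) (b k) < \<delta>"
      if k: "k < ?n" for k
    proof (rule boost_contracts[OF compact[OF k] _ _ _ \<delta>])
      show "range (curve D k) \<subseteq> sphere 0 1"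
        using g1[OF k] by auto
      show "norm (b k) = 1" "- b k \<notin> range (curve D k)"
        using b k by simp_all
    qed
    from this[OF ij(1)] this[OF ij(2)] show ?thesis
    proof eventually_elim
      case (elim s)
      show ?case
      proof (intro allI notI)
        fix t t' assume eq: "boost (s *\<^sub>R b i) (curve D i t) = boost (s *\<^sub>R b j) (curve D j t')"
        have "dist (boost (s *\<^sub>R b i) (curve D i t)) (b i) < \<delta>"
          "dist (boost (s *\<^sub>R b j) (curve D j t')) (b j) < \<delta>"
          using elim by auto
        then show False
          using dist_triangle3[of "b i" "b j" "boost (s *\<^sub>R b i) (curve D i t)"] unfolding eq by (simp add: \<delta>_def)
      qed
    qed
  qed
  have "\<forall>\<^sub>F s in at_left (1::real). \<forall>i\<in>{..<?n}. \<forall>j\<in>{..<?n}. i \<noteq> j \<longrightarrow>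
      (\<forall>t t'. boost (s *\<^sub>R b i) (curve D i t) \<noteq> boost (s *\<^sub>R b j) (curve D j t'))"
    by (intro eventually_ball_finite ballI finite_lessThan)
      (use separated in \<open>auto intro: eventually_mono\<close>)
  moreover have "\<forall>\<^sub>F s in at_left (1::real). 0 < s"
    by (rule order_tendstoD[OF tendsto_ident_at]) auto
  moreover have "\<forall>\<^sub>F s in at_left (1::real). s < 1"
    by (simp add: eventually_at_filter)
  ultimately have "\<forall>\<^sub>F s in at_left (1::real). (\<forall>i\<in>{..<?n}. \<forall>j\<in>{..<?n}. i \<noteq> j \<longrightarrow>
      (\<forall>t t'. boost (s *\<^sub>R b i) (curve D i t) \<noteq> boost (s *\<^sub>R b j) (curve D j t'))) \<and> 0 < s \<and> s < 1"
    by eventually_elim blast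
  from eventually_happens'[OF trivial_limit_at_left_real this]
  obtain s :: real where sep: "\<forall>i\<in>{..<?n}. \<forall>j\<in>{..<?n}. i \<noteq> j \<longrightarrow>
      (\<forall>t t'. boost (s *\<^sub>R b i) (curve D i t) \<noteq> boost (s *\<^sub>R b j) (curve D j t'))"
    and s: "0 < s" "s < 1"
    by (elim exE conjE)
  define c where "c = (\<lambda>i. s *\<^sub>R b i)"
  have c: "norm (c i) = s" for i
    using s b by (simp add: c_def)
  have c1: "norm (c i) < 1" if "i < ?n" for i
    using s by (simp add: c)
  have apart: "boost (c i) (curve D i t) \<noteq> boost (c j) (curve D j t')"
    if "i < ?n" "j < ?n" "i \<noteq> j" for i j t t'
    using sep that by (simp add: c_def)
  let ?E = "boost_components c D"

  have fin_U: "finite {t. (i, t) \<in> underpasses D}" for i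
  proof -
    have "underpasses D \<subseteq> (\<Union>p\<in>crossings D. strands_at D p)"
      using D by (fastforce simp: link_diagram_def strands_at_def)
    moreover have "finite (\<Union>p\<in>crossings D. strands_at D p)"
      using D by (auto simp: link_diagram_def)
    ultimately have "finite (underpasses D)"
      by (rule finite_subset)
    moreover have "{t. (i, t) \<in> underpasses D} \<subseteq> snd ` underpasses D"
      by force
    ultimately show ?thesis
      using finite_subset by blast
  qed
  have sub_U: "{t. (i, t) \<in> underpasses D} \<subseteq> {0..<1}" for i
    using D by (auto simp: link_diagram_def passages_def)
  have "\<forall>i. \<exists>f :: real \<Rightarrow> real. f C1_differentiable_on UNIV \<and> (\<forall>t. f (t + 1) = f t) \<and> (\<forall>t. 0 \<le> f t \<and> f t \<le> 1) \<and>
      (\<forall>t\<in>{0..<1}. f t = 0 \<longleftrightarrow> (i, t) \<in> underpasses D)"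
  proof
    fix i
    show "\<exists>f :: real \<Rightarrow> real. f C1_differentiable_on UNIV \<and> (\<forall>t. f (t + 1) = f t) \<and> (\<forall>t. 0 \<le> f t \<and> f t \<le> 1) \<and>
        (\<forall>t\<in>{0..<1}. f t = 0 \<longleftrightarrow> (i, t) \<in> underpasses D)"
      using periodic_C1_function_with_zeros[OF fin_U[of i] sub_U[of i]] by simp
  qed
  from choice[OF this]
  obtain f :: "nat \<Rightarrow> real \<Rightarrow> real" where
    "\<forall>i. f i C1_differentiable_on UNIV \<and> (\<forall>t. f i (t + 1) = f i t) \<and> (\<forall>t. 0 \<le> f i t \<and> f i t \<le> 1) \<and>
      (\<forall>t\<in>{0..<1}. f i t = 0 \<longleftrightarrow> (i, t) \<in> underpasses D)"
    by (elim exE)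
  then have f: "\<And>i. f i C1_differentiable_on UNIV" "\<And>i t. f i (t + 1) = f i t"
      "\<And>i t. 0 \<le> f i t" "\<And>i t. f i t \<le> 1"
      "\<And>i t. t \<in> {0..<1} \<Longrightarrow> f i t = 0 \<longleftrightarrow> (i, t) \<in> underpasses D"
    by simp_all
  \<comment> \<open>Adding 1 keeps the radii of the lowest layer positive.\<close>
  define \<rho> where "\<rho> = (\<lambda>i t. real (Suc (m i)) + f i t / 4)"
  have \<rho>_pos: "\<rho> i t > 0" for i t
    using f(3)[of i t] by (simp add: \<rho>_def)
  have \<rho>_C1: "\<rho> i C1_differentiable_on UNIV" for i
  proof -
    have "(\<lambda>t. real (Suc (m i)) + (1/4) *\<^sub>R f i t) C1_differentiable_on UNIV"
      by (intro C1_differentiable_on_add C1_differentiable_on_const C1_differentiable_on_scaleR f)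
    then show ?thesis
      by (simp add: \<rho>_def)
  qed
  have \<rho>_periodic: "\<rho> i (t + 1) = \<rho> i t" for i t
    by (simp add: \<rho>_def f)
  have \<rho>_order: "\<rho> i s < \<rho> j t"
    if p: "p \<in> crossings D" and st: "(i, s) \<in> strands_at D p" "(j, t) \<in> strands_at D p"
      and u: "(i, s) \<in> underpasses D" "(j, t) \<notin> underpasses D" for p i s j t
  proof -
    have P: "s \<in> {0..<1}" "t \<in> {0..<1}"
      using st by (auto simp: strands_at_def passages_def)
    then have fs: "f i s = 0" "f j t > 0"
      using f(3)[of j t] f(5)[of s i] f(5)[of t j] u by auto
    show ?thesis
    proof (cases "i = j")
      case True
      then show ?thesis
        using fs by (simp add: \<rho>_def)
    next
      case False
      have "finite (strands_at D p)" "card (strands_at D p) = 2"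
        using D p by (auto simp: link_diagram_def crossings_def)
      then have "{(i, s), (j, t)} = strands_at D p"
        using st False by (intro card_subset_eq) auto
      then have "m i < m j"
        using layered[OF p, of i s j t] u False by simp
      then show ?thesis
        using fs by (simp add: \<rho>_def)
    qed
  qed
  define L where "L = (\<lambda>(i, t). \<rho> i t *\<^sub>R curve D i t) ` passages D"
  have "projects_to L D"
    unfolding projects_to_def using \<rho>_pos \<rho>_C1 \<rho>_periodic \<rho>_order
    by (intro exI[of _ \<rho>]) (auto simp: L_def)
  moreover have "ambient_isotopic L L"
  proof -
    have "(\<lambda>z :: real^3. norm z *\<^sub>R boost 0 (sgn z)) = (\<lambda>z. z)"
    proof
      show "norm z *\<^sub>R boost 0 (sgn z) = z" for z :: "real^3"
        by (cases "z = 0") (simp_all add: boost_def sgn_div_norm)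
    qed
    moreover have "ambient_isotopic L ((\<lambda>z. norm z *\<^sub>R boost 0 (sgn z)) ` L)"
      by (rule ambient_isotopic_twist) simp_all
    ultimately show ?thesis
      by (simp only: image_ident)
  qed
  ultimately have "diagram_of D L"
    using D by (auto simp: diagram_of_def)

  have "inj_on (\<lambda>i. Suc (m i)) {..<?n}"
    using m by (simp add: inj_on_def)
  from continuous_function_with_plateaus[OF finite_lessThan this, of c s]
  obtain a :: "real \<Rightarrow> real^3" where a: "continuous_on UNIV a" "\<forall>r. norm (a r) \<le> s"
      "\<forall>i\<in>{..<?n}. \<forall>r. \<bar>r - real (Suc (m i))\<bar> \<le> 1/4 \<longrightarrow> a r = c i"
    using s c by auto
  let ?T = "\<lambda>z. norm z *\<^sub>R boost (a (norm z)) (sgn z)"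
  have T: "?T (\<rho> i t *\<^sub>R curve D i t) = \<rho> i t *\<^sub>R boost (c i) (curve D i t)" if i: "i < ?n" for i t
  proof -
    have "a (\<rho> i t) = c i"
      using a(3) i f(3,4)[of i t] by (simp add: \<rho>_def)
    moreover have "norm (\<rho> i t *\<^sub>R curve D i t) = \<rho> i t"
      using g1[OF i] \<rho>_pos[of i t] by simp
    moreover have "sgn (\<rho> i t *\<^sub>R curve D i t) = curve D i t"
      using g1[OF i] \<rho>_pos[of i t] by (simp add: sgn_div_norm)
    ultimately show ?thesis
      by simp
  qed
  have "projects_to (?T ` L) ?E"
    unfolding projects_to_def
  proof (intro exI[of _ \<rho>] conjI)
    show "\<forall>p\<in>crossings ?E. \<forall>(i, s)\<in>strands_at ?E p. \<forall>(j, t)\<in>strands_at ?E p.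
        (i, s) \<in> underpasses ?E \<and> (j, t) \<notin> underpasses ?E \<longrightarrow> \<rho> i s < \<rho> j t"
    proof (intro ballI, clarify)
      fix p i s j t
      assume p: "p \<in> crossings ?E" and st: "(i, s) \<in> strands_at ?E p" "(j, t) \<in> strands_at ?E p"
        and u: "(i, s) \<in> underpasses ?E" "(j, t) \<notin> underpasses ?E"
      obtain x where x: "point_at D x \<in> crossings D" "strands_at ?E p = strands_at D (point_at D x)"
          "\<And>y. y \<in> strands_at D (point_at D x) \<Longrightarrow> fst y = fst x"
        by (rule crossing_boost_componentsE[OF D c1 apart p]) auto
      have "point_at D (j, t) = point_at D x"
        using st(2) unfolding x(2) by (simp add: strands_at_def)
      then have "(j, t) \<notin> underpasses D"
        using u(2) x(3) st(2) unfolding x(2) boost_components_simps by auto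
      then show "\<rho> i s < \<rho> j t"
        using \<rho>_order[OF x(1)] st u(1) unfolding x(2) by simp
    qed
    show "?T ` L = (\<lambda>(i, t). \<rho> i t *\<^sub>R curve ?E i t) ` passages ?E"
      unfolding L_def image_image boost_components_simps
      by (rule image_cong) (use T in \<open>auto simp: passages_def\<close>)
  qed (use \<rho>_C1 \<rho>_pos \<rho>_periodic in auto)
  moreover have "ambient_isotopic L (?T ` L)"
    using a(1,2) s by (intro ambient_isotopic_twist) (auto intro: le_less_trans)
  ultimately have "completely_splittable L"
    unfolding completely_splittable_def diagram_of_def
    using link_diagram_boost_components[OF D c1 apart] nonself_crossings_boost_components[OF D c1 apart]
    by blast
  with \<open>diagram_of D L\<close> show ?thesis
    by blast
qed

section \<open>Crossing changes and warping degrees\<close>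

lemma change_crossings_simps [simp]:
  "num_components (change_crossings D S) = num_components D"
  "passages (change_crossings D S) = passages D"
  "curve (change_crossings D S) = curve D"
  "point_at (change_crossings D S) = point_at D"
  "velocity (change_crossings D S) = velocity D"
  "strands_at (change_crossings D S) = strands_at D"
  "crossings (change_crossings D S) = crossings D"
  "underpasses (change_crossings D S) = sym_diff (underpasses D) {x \<in> passages D. point_at D x \<in> S}"
  by (simp_all add: change_crossings_def passages_def point_at_def[abs_def] velocity_def[abs_def]
      strands_at_def[abs_def] crossings_def)

text \<open>
  A crossing has two strands, and exactly one of them is the under-strand; so exchanging the two leaves
  exactly one again.
\<close>

lemma link_diagram_change_crossings:
  assumes D: "link_diagram D" and S: "S \<subseteq> crossings D"
  shows "link_diagram (change_crossings D S)"
proof -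
  let ?U = "sym_diff (underpasses D) {x \<in> passages D. point_at D x \<in> S}"
  have "\<forall>p\<in>crossings D. card (strands_at D p \<inter> ?U) = 1"
  proof
    fix p assume p: "p \<in> crossings D"
    show "card (strands_at D p \<inter> ?U) = 1"
    proof (cases "p \<in> S")
      case True
      then have "strands_at D p \<inter> ?U = strands_at D p - (strands_at D p \<inter> underpasses D)"
        by (auto simp: strands_at_def)
      moreover have "card (strands_at D p - (strands_at D p \<inter> underpasses D)) = 2 - 1"
        using D p by (subst card_Diff_subset) (auto simp: link_diagram_def crossings_def)
      ultimately show ?thesis
        by simp
    next
      case False
      then have "strands_at D p \<inter> ?U = strands_at D p \<inter> underpasses D"
        by (auto simp: strands_at_def)
      then show ?thesis
        using D p by (simp add: link_diagram_def)
    qed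
  qed
  moreover have "?U \<subseteq> {x \<in> passages D. point_at D x \<in> crossings D}"
    using D S by (auto simp: link_diagram_def)
  ultimately show ?thesis
    using D unfolding link_diagram_def change_crossings_simps
    by (elim conjE) (intro conjI; assumption)
qed

text \<open>
  After these changes every earlier component in the order of \<open>a\<close> passes over every later one, so the
  diagram is layered, and the layer of a component is its position counted from the end.
\<close>

lemma splits_by_changing_nonself_warping_crossings:
  assumes D: "link_diagram D" and a: "base_point_sequence D a"
  shows "splits_by_changing D (nonself_warping_crossings D a)"
proof -
  let ?W = "nonself_warping_crossings D a"
  have dist: "distinct (map fst a)" and img: "fst ` set a = {..<num_components D}"
    using a by (auto simp: base_point_sequence_def)
  have "\<forall>i\<in>{..<num_components D}. \<exists>k<length a. fst (a ! k) = i"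
    unfolding img[symmetric] by (auto simp: in_set_conv_nth) (metis fst_conv)
  then obtain pos where pos: "\<And>i. i < num_components D \<Longrightarrow> pos i < length a \<and> fst (a ! pos i) = i"
    by (metis lessThan_iff)
  have pos_eq: "pos (fst (a ! k)) = k" if "k < length a" for k
  proof -
    have "fst (a ! k) < num_components D"
      using img that nth_mem by blast
    then have "pos (fst (a ! k)) < length a" "map fst a ! pos (fst (a ! k)) = map fst a ! k"
      using pos that by auto
    then show ?thesis
      using dist that by (simp add: nth_eq_iff_index_eq del: nth_map)
  qed
  \<comment> \<open>The earliest component has to be the highest one.\<close>
  define m where "m = (\<lambda>i. length a - pos i)"
  have "\<exists>L. diagram_of (change_crossings D ?W) L \<and> completely_splittable L"
  proof (rule layered_diagram_completely_splittable)
    show "link_diagram (change_crossings D ?W)"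
      by (rule link_diagram_change_crossings[OF D]) (auto simp: nonself_warping_crossings_def)
    show "inj_on m {..<num_components (change_crossings D ?W)}"
    proof (rule inj_onI, simp)
      fix i j assume ij: "i < num_components D" "j < num_components D" "m i = m j"
      then have "pos i = pos j"
        using pos[OF ij(1)] pos[OF ij(2)] unfolding m_def by linarith
      then show "i = j"
        using pos ij by metis
    qed
    fix p i j s t
    assume "p \<in> crossings (change_crossings D ?W)" "strands_at (change_crossings D ?W) p = {(i, s), (j, t)}"
      and ij: "i \<noteq> j" and u: "(i, s) \<in> underpasses (change_crossings D ?W)"
    then have p: "p \<in> crossings D" and st: "strands_at D p = {(i, s), (j, t)}"
      by simp_all
    have "(i, s) \<in> strands_at D p" "(j, t) \<in> strands_at D p"
      using st by auto
    then have P: "(i, s) \<in> passages D" "point_at D (i, s) = p" "i < num_components D" "j < num_components D"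
      by (auto simp: strands_at_def passages_def)
    have "pos j < pos i"
    proof (rule ccontr)
      assume "\<not> pos j < pos i"
      then have less: "pos i < pos j"
        using pos[OF P(3)] pos[OF P(4)] ij by (metis linorder_neqE_nat)
      show False
      proof (cases "(i, s) \<in> underpasses D")
        case True
        then have "p \<in> ?W"
          unfolding nonself_warping_crossings_def using p st less pos[OF P(3)] pos[OF P(4)] by fastforce
        then show False
          using u P True by simp
      next
        case False
        then have "p \<in> ?W"
          using u P by simp
        then obtain k l s' t' where kl: "k < l" "l < length a" "(fst (a ! k), s') \<in> underpasses D"
          "{(i, s), (j, t)} = {(fst (a ! k), s'), (fst (a ! l), t')}"
          unfolding nonself_warping_crossings_def st[symmetric] by blast
        then have "j = fst (a ! k)" "i = fst (a ! l)"
          using False by (auto simp: doubleton_eq_iff)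
        then show False
          using kl less pos_eq[of k] pos_eq[of l] by simp
      qed
    qed
    then show "m i < m j"
      using pos[OF P(3)] by (auto simp: m_def intro: diff_less_mono2)
  qed
  then show ?thesis
    by (simp add: splits_by_changing_def)
qed

text \<open>
  Only finitely many passages go through crossings.
\<close>

lemma base_point_sequence_exists:
  assumes D: "link_diagram D"
  shows "\<exists>a. base_point_sequence D a"
proof -
  have "\<exists>t\<in>{0..<1}. point_at D (i, t) \<notin> crossings D" if i: "i < num_components D" for i
  proof (rule ccontr)
    assume "\<not> ?thesis"
    then have "{0..<1} \<subseteq> snd ` (\<Union>p\<in>crossings D. strands_at D p)"
      using i by (force simp: strands_at_def passages_def image_iff)
    moreover have "finite (snd ` (\<Union>p\<in>crossings D. strands_at D p))"
      using D by (auto simp: link_diagram_def)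
    ultimately show False
      using infinite_Ico[of "0::real" 1] by (meson finite_subset zero_less_one)
  qed
  then obtain t where t: "\<And>i. i < num_components D \<Longrightarrow> t i \<in> {0..<1} \<and> point_at D (i, t i) \<notin> crossings D"
    by metis
  have "base_point_sequence D (map (\<lambda>i. (i, t i)) [0..<num_components D])"
    using t by (force simp: base_point_sequence_def passages_def comp_def image_image)
  then show ?thesis
    by blast
qed

lemma nonself_warping_crossings_subset:
  assumes a: "base_point_sequence D a"
  shows "nonself_warping_crossings D a \<subseteq> nonself_crossings D"
proof
  fix p assume "p \<in> nonself_warping_crossings D a"
  then obtain k l s t where p: "p \<in> crossings D" "k < l" "l < length a"
      "strands_at D p = {(fst (a ! k), s), (fst (a ! l), t)}"
    by (auto simp: nonself_warping_crossings_def)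
  have "distinct (map fst a)"
    using a by (simp add: base_point_sequence_def)
  then have "fst (a ! k) \<noteq> fst (a ! l)"
    using p nth_eq_iff_index_eq[of "map fst a" k l] by simp
  then show "p \<in> nonself_crossings D"
    using p by (auto simp: nonself_crossings_def)
qed

text \<open>
  The under-strand of a crossing belongs to the earlier component for one of the orders \<open>a\<close> and
  \<open>rev a\<close> only.
\<close>

lemma nonself_warping_crossings_rev_disjoint:
  assumes D: "link_diagram D" and a: "base_point_sequence D a"
  shows "nonself_warping_crossings D a \<inter> nonself_warping_crossings D (rev a) = {}"
proof (rule ccontr)
  assume "\<not> ?thesis"
  then obtain p where p1: "p \<in> nonself_warping_crossings D a" and p2: "p \<in> nonself_warping_crossings D (rev a)"
    by blast
  obtain k l s t where kl: "p \<in> crossings D" "k < l" "l < length a"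
      "strands_at D p = {(fst (a ! k), s), (fst (a ! l), t)}" "(fst (a ! k), s) \<in> underpasses D"
    using p1 by (auto simp: nonself_warping_crossings_def)
  obtain k' l' s' t' where kl': "k' < l'" "l' < length a"
      "strands_at D p = {(fst (rev a ! k'), s'), (fst (rev a ! l'), t')}" "(fst (rev a ! k'), s') \<in> underpasses D"
    using p2 by (auto simp: nonself_warping_crossings_def)
  have inj: "i = j" if "i < length a" "j < length a" "fst (a ! i) = fst (a ! j)" for i j
    using a that nth_eq_iff_index_eq[of "map fst a" i j] by (simp add: base_point_sequence_def)
  have "card (strands_at D p \<inter> underpasses D) = 1"
    using D kl(1) by (auto simp: link_diagram_def)
  then obtain u where u: "strands_at D p \<inter> underpasses D = {u}"
    by (auto simp: card_1_singleton_iff)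
  have "(fst (a ! k), s) \<in> {u}" "(fst (rev a ! k'), s') \<in> {u}"
    using kl kl' unfolding u[symmetric] by blast+
  then have "(fst (a ! k), s) = (fst (rev a ! k'), s')"
    by simp
  moreover from this have "(fst (a ! l), t) = (fst (rev a ! l'), t')"
    using kl(4) kl'(3) by (auto simp: doubleton_eq_iff)
  ultimately have "fst (a ! k) = fst (a ! (length a - Suc k'))" "fst (a ! l) = fst (a ! (length a - Suc l'))"
    using kl' by (simp_all add: rev_nth)
  then have "k = length a - Suc k'" "l = length a - Suc l'"
    using kl kl' by (auto intro!: inj)
  then show False
    using kl kl' by linarith
qed

theorem proposition7p1:
  fixes D :: diagram
  assumes "link_diagram D"
  shows "split D \<le> unoriented_warping_degree D \<and>
    (split D \<le> lsplit D \<and> lsplit D \<le> ld D \<and>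
     real (ld D) \<le> real (lc D) / 2 \<and> real (lc D) / 2 \<le> real (crossing_number D) / 2)"
proof -
  note D = assms
  have fin: "finite (crossings D)"
    using D by (simp add: link_diagram_def)
  have sub: "nonself_crossings D \<subseteq> crossings D"
    by (auto simp: nonself_crossings_def)
  have lsplit_le: "lsplit D \<le> linking_warping_degree_at D a" if a: "base_point_sequence D a" for a
    unfolding linking_complete_splitting_number_def linking_warping_degree_at_def
    by (rule Least_le)
      (use nonself_warping_crossings_subset[OF a] splits_by_changing_nonself_warping_crossings[OF D a] in blast)
  obtain a0 where a0: "base_point_sequence D a0"
    using base_point_sequence_exists[OF D] by blast
  have "\<exists>n. \<exists>S\<subseteq>nonself_crossings D. card S = n \<and> splits_by_changing D S"
    using nonself_warping_crossings_subset[OF a0] splits_by_changing_nonself_warping_crossings[OF D a0] by blast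
  from LeastI_ex[OF this] obtain S where "S \<subseteq> nonself_crossings D" "card S = lsplit D" "splits_by_changing D S"
    unfolding linking_complete_splitting_number_def by blast
  then have split_le: "split D \<le> lsplit D"
    unfolding complete_splitting_number_def by (intro Least_le) (use sub in blast)
  have ld_le: "ld D \<le> linking_warping_degree_at D a" if "base_point_sequence D a" for a
    unfolding linking_warping_degree_def by (rule Least_le) (use that in blast)
  have "\<exists>n. \<exists>a. base_point_sequence D a \<and> linking_warping_degree_at D a = n"
    using a0 by blast
  from LeastI_ex[OF this] obtain a where a: "base_point_sequence D a" "linking_warping_degree_at D a = ld D"
    unfolding linking_warping_degree_def by blast
  have "lsplit D \<le> ld D"
    using lsplit_le[OF a(1)] a(2) by simp
  \<comment> \<open>The two degrees for an order and its reverse add up to at most the number of non-self crossings.\<close>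
  moreover have "2 * ld D \<le> lc D"
  proof -
    have rev: "base_point_sequence D (rev a0)"
      using a0 by (simp add: base_point_sequence_def rev_map[symmetric])
    have "2 * ld D \<le> card (nonself_warping_crossings D a0) + card (nonself_warping_crossings D (rev a0))"
      using ld_le[OF a0] ld_le[OF rev] by (simp add: linking_warping_degree_at_def)
    also have "\<dots> = card (nonself_warping_crossings D a0 \<union> nonself_warping_crossings D (rev a0))"
      using fin by (intro card_Un_disjoint[symmetric] nonself_warping_crossings_rev_disjoint[OF D a0])
        (auto simp: nonself_warping_crossings_def)
    also have "\<dots> \<le> lc D"
      unfolding nonself_crossing_number_def
      using nonself_warping_crossings_subset[OF a0] nonself_warping_crossings_subset[OF rev] finite_subset[OF sub fin]
      by (intro card_mono) auto
    finally show ?thesis .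
  qed
  moreover have "lc D \<le> crossing_number D"
    unfolding nonself_crossing_number_def crossing_number_def by (rule card_mono[OF fin sub])
  moreover have "split D \<le> unoriented_warping_degree D"
  proof -
    have "\<exists>n. \<exists>e. warping_degree D e = n"
      by blast
    from LeastI_ex[OF this] obtain e where e: "warping_degree D e = unoriented_warping_degree D"
      unfolding unoriented_warping_degree_def by blast
    have "\<exists>n. \<exists>a. base_point_sequence D a \<and> warping_degree_at D e a = n"
      using a0 by blast
    from LeastI_ex[OF this] obtain a where a: "base_point_sequence D a" "warping_degree_at D e a = warping_degree D e"
      unfolding warping_degree_def by blast
    \<comment> \<open>Changing the non-self warping crossings alone already splits the link.\<close>
    have "split D \<le> linking_warping_degree_at D a"
      using split_le lsplit_le[OF a(1)] by simp
    also have "\<dots> \<le> warping_degree_at D e a"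
      by (simp add: linking_warping_degree_at_def warping_degree_at_def)
    finally show ?thesis
      using a(2) e by simp
  qed
  ultimately show ?thesis
    using split_le by linarith
qed

end
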